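(* Let $k\ge 4$ and $1 \le t\le \min\{2k,\, 2^{\lceil \log_2 k\rceil}+4\}$ be integers. Then $f_k(n,t)=O(\sqrt{\log n})$.
   Context: Let $[n]=\{1,\dots,n\}$. A permutation $\rho$ of a finite set $X$ is a total order $<_\rho$ of the elements of $X$; if $Y\subseteq X$, then $\rho$ induces a permutation on $Y$ by restricting the order. For $t\ge 1$, a family $\mathcal{P}$ of permutations of $[n]$ $t$-shatters a set $X\subseteq[n]$ if the permutations of $\mathcal{P}$ induce at least $t$ distinct permutations on $X$. For $n \ge k$, $f_k(n,t)$ denotes the minimum number of permutations in a family of permutations of $[n]$ that $t$-shatters every subset of $[n]$ of size $k$. Asymptotic notation is for $k$ and $t$ fixed and $n\to\infty$; the implied constants may depend on $k$ and $t$. *)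

theory Defs
  imports Complex_Main "HOL-Library.Landau_Symbols"
begin

text \<open>
  A permutation of \<open>X\<close> is a strict total order on \<open>X\<close>, given as the set of pairs \<open>(x, y)\<close> with
  \<open>x\<close> before \<open>y\<close>. The inclusion in \<open>X \<times> X\<close> is not implied by \<^const>\<open>strict_linear_order_on\<close>;
  it makes equality of relations coincide with equality of orders on \<open>X\<close>.
\<close>
definition perms_on :: "'a set \<Rightarrow> 'a rel set" where
  "perms_on X = {r. r \<subseteq> X \<times> X \<and> strict_linear_order_on X r}"

definition induced_perms :: "'a rel set \<Rightarrow> 'a set \<Rightarrow> 'a rel set" where
  "induced_perms P Y = (\<lambda>r. Restr r Y) ` P"

text \<open>
  The induced permutations are counted without repetition. For finite \<open>X\<close> (the only case used)
  \<^term>\<open>induced_perms P X\<close> is finite, so \<^const>\<open>card\<close> is the genuine number of elements.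
\<close>
definition t_shatters :: "nat \<Rightarrow> 'a rel set \<Rightarrow> 'a set \<Rightarrow> bool" where
  "t_shatters t P X \<longleftrightarrow> t \<le> card (induced_perms P X)"

text \<open>
  The minimum size of a family of permutations of \<open>{1..n}\<close> that \<open>t\<close>-shatters every \<open>k\<close>-subset.
  Such a family exists whenever \<open>t \<le> k!\<close> (take all permutations); otherwise, for \<open>n \<ge> k\<close>, the
  minimum does not exist and \<^const>\<open>Least\<close> returns an unspecified number.
\<close>
definition shatter_num :: "nat \<Rightarrow> nat \<Rightarrow> nat \<Rightarrow> nat" where
  "shatter_num k n t = (LEAST m. \<exists>P. P \<subseteq> perms_on {1..n} \<and> card P = m \<and>
     (\<forall>X. X \<subseteq> {1..n} \<and> card X = k \<longrightarrow> t_shatters t P X))"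

text \<open>The restriction of a permutation to a subset is a permutation of that subset.\<close>
lemma induced_perms_subset:
  assumes "P \<subseteq> perms_on X" "Y \<subseteq> X"
  shows "induced_perms P Y \<subseteq> perms_on Y"
proof
  fix s assume "s \<in> induced_perms P Y"
  then obtain r where r: "r \<in> P" "s = Restr r Y"
    by (auto simp: induced_perms_def)
  then have "trans r" "irrefl r" "total_on X r"
    using assms by (auto simp: perms_on_def strict_linear_order_on_def)
  then have "trans s" "irrefl s" "total_on Y s"
    using assms(2) r(2) by (auto simp: trans_Restr irrefl_def total_on_def)
  then show "s \<in> perms_on Y"
    using r(2) by (auto simp: perms_on_def strict_linear_order_on_def)
qed

lemma finite_perms_on: "finite X \<Longrightarrow> finite (perms_on X)"
  by (rule finite_subset[of _ "Pow (X \<times> X)"]) (auto simp: perms_on_def)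

end

theory Submission
  imports Defs "HOL-Library.FuncSet"
begin

text \<open>
  The square root comes from balancing a number of digits against the size of an alphabet. With
  \<open>m\<close> about \<open>sqrt (log n)\<close>, the points \<open>1, \<dots>, n\<close> receive distinct codes of \<open>m\<close> digits over an
  alphabet of size \<open>2 ^ m\<close>. Two kinds of permutations are used, \<open>O(m)\<close> of each kind.

  The first kind consists of lexicographic orders, where every position has its own order of the
  alphabet. There are \<open>m * 2 ^ m\<close> pairs of a position and a digit, and a set of \<open>k\<close> points involves
  at most \<open>k ^ 3\<close> of them in an essential way, because at most \<open>k\<^sup>2\<close> positions are the first
  difference of two of its points. A greedy covering argument (\<open>universal_family_log\<close>) shows that
  \<open>O(log (m * 2 ^ m)) = O(m)\<close> choices of digit orders realise every pattern on \<open>k ^ 3\<close> such pairs. So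
  on each \<open>k\<close>-set \<open>X\<close> this family induces every order that any lexicographic order
  induces (\<open>lex_orders_realised\<close>).

  To count these orders, view \<open>X\<close> as the leaves of its prefix tree. An order induced on \<open>X\<close> amounts
  to an independent choice, for each position, of an acyclic orientation of the graph that joins two
  digits when some node branches into both at that position. If \<open>q\<close> is the largest number of children
  of a node at the position, then \<open>card X\<close> is at most the product of the \<open>q\<close>, while the number of
  orientations is at least \<open>2 * q\<close>, unless all branching nodes at this position are binary with
  the same pair of children, or there are none; in these cases it is at least \<open>q\<close>
  (\<open>orientations_dichotomy\<close>). So either there are \<open>2 * k\<close> orders, or every position is exceptional
  and, with \<open>b\<close> the number of branching positions, there are at least \<open>2 ^ b \<ge> k\<close> orders. If no position
  has two branching nodes, then the tree has \<open>b\<close> branching nodes, all binary, so that \<open>k = b + 1\<close>,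
  and \<open>2 ^ b \<ge> 2 * k\<close> because \<open>k \<ge> 4\<close>.

  There remains the case that two nodes at the same position \<open>j\<close> branch into the same pair of
  digits. It is the reason for the second kind of permutations: for every position \<open>j\<close>, the four orders
  that compare the digit at \<open>j\<close> first, upwards or downwards, and break ties upwards or downwards.
  A lexicographic order keeps the points below the two nodes apart, whereas comparing digit \<open>j\<close> first
  interleaves them; so these four orders are new (\<open>twin_branching_four_new_orders\<close>) and give
  \<open>2 ^ b + 4\<close> orders in total.
\<close>

section \<open>Small families of functions that realise every small pattern\<close>

text \<open>
  By double counting, some \<open>f\<close> satisfies a fraction \<open>\<delta>\<close> of the constraints not yet satisfied. Choosing
  such an \<open>f\<close> again and again shrinks the set of unsatisfied constraints by the factor \<open>1 - \<delta>\<close> each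
  time.
\<close>
lemma greedy_cover:
  fixes \<delta> :: real
  assumes fin: "finite F" "finite C" and ne: "F \<noteq> {}" and le1: "\<delta> \<le> 1"
    and dense: "\<And>c. c \<in> C \<Longrightarrow> \<delta> * real (card F) \<le> real (card {f \<in> F. sat f c})"
  shows "\<exists>P\<subseteq>F. card P \<le> M \<and>
           real (card {c \<in> C. \<forall>f\<in>P. \<not> sat f c}) \<le> (1 - \<delta>) ^ M * real (card C)"
proof (induction M)
  case 0
  then show ?case by (intro exI[of _ "{}"]) auto
next
  case (Suc M)
  then obtain P where P: "P \<subseteq> F" "card P \<le> M"
    and bound: "real (card {c \<in> C. \<forall>f\<in>P. \<not> sat f c}) \<le> (1 - \<delta>) ^ M * real (card C)"
    by blast
  define U where "U = {c \<in> C. \<forall>f\<in>P. \<not> sat f c}"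
  have finU: "finite U" using fin by (simp add: U_def)
  have "\<exists>f\<in>F. \<delta> * real (card U) \<le> real (card {c \<in> U. sat f c})"
  proof (rule ccontr)
    assume "\<not> ?thesis"
    then have lt: "\<And>f. f \<in> F \<Longrightarrow> real (card {c \<in> U. sat f c}) < \<delta> * real (card U)"
      by force
    have count: "real (card {x \<in> S. Q x}) = (\<Sum>x\<in>S. if Q x then 1 else 0)"
      if "finite S" for S :: "'x set" and Q
      using that by (simp add: sum.If_cases Int_def)
    have "real (card F) * (\<delta> * real (card U)) = (\<Sum>c\<in>U. \<delta> * real (card F))"
      by simp
    also have "\<dots> \<le> (\<Sum>c\<in>U. real (card {f \<in> F. sat f c}))"
      by (intro sum_mono dense) (auto simp: U_def)
    also have "\<dots> = (\<Sum>f\<in>F. real (card {c \<in> U. sat f c}))"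
      using fin finU by (simp only: count) (rule sum.swap)
    also have "\<dots> < (\<Sum>f\<in>F. \<delta> * real (card U))"
      using lt fin ne by (intro sum_strict_mono) auto
    finally show False by simp
  qed
  then obtain f where f: "f \<in> F" "\<delta> * real (card U) \<le> real (card {c \<in> U. sat f c})"
    by blast
  have split: "card U = card {c \<in> U. sat f c} + card {c \<in> U. \<not> sat f c}"
    using finU by (subst card_Un_disjoint[symmetric]) (auto intro: arg_cong[where f = card])
  have "real (card {c \<in> U. \<not> sat f c}) \<le> (1 - \<delta>) * real (card U)"
    using f(2) split by (simp add: algebra_simps)
  also have "\<dots> \<le> (1 - \<delta>) * ((1 - \<delta>) ^ M * real (card C))"
    using bound le1 by (intro mult_left_mono) (auto simp: U_def)
  finally have "real (card {c \<in> U. \<not> sat f c}) \<le> (1 - \<delta>) ^ Suc M * real (card C)"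
    by (simp add: mult.assoc)
  moreover have "{c \<in> U. \<not> sat f c} = {c \<in> C. \<forall>f\<in>insert f P. \<not> sat f c}"
    by (auto simp: U_def)
  moreover have "card (insert f P) \<le> Suc M"
    using P fin by (metis card_insert_le_m1 card.insert_remove card_insert_if finite_subset le_SucI not_less_eq_eq)
  ultimately show ?case
    using P f by (intro exI[of _ "insert f P"]) auto
qed

definition pattern_universal :: "nat \<Rightarrow> 'g set \<Rightarrow> ('g \<Rightarrow> nat) set \<Rightarrow> bool" where
  "pattern_universal K G P \<longleftrightarrow> P \<subseteq> G \<rightarrow>\<^sub>E {..<K} \<and>
     (\<forall>S p. S \<subseteq> G \<and> card S = K \<and> p \<in> S \<rightarrow> {..<K} \<longrightarrow> (\<exists>g\<in>P. \<forall>x\<in>S. g x = p x))"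

text \<open>
  The constraints are the pairs of a \<open>K\<close>-subset \<open>S\<close> of \<open>G\<close> and a pattern on \<open>S\<close>. There are at most
  \<open>card G ^ K * K ^ K\<close> of them, and each holds for exactly the fraction \<open>1 / K ^ K\<close> of all functions
  from \<open>G\<close> to \<open>{..<K}\<close>. After \<open>M\<close> greedy choices fewer than one constraint is left.
\<close>
lemma universal_family:
  fixes G :: "'g set" and K :: nat
  assumes finG: "finite G" and K: "0 < K"
    and small: "real (card G ^ K * K ^ K) * (1 - 1 / real (K ^ K)) ^ M < 1"
  shows "\<exists>P. pattern_universal K G P \<and> card P \<le> M"
proof -
  define F where "F = (G \<rightarrow>\<^sub>E {..<K})"
  define Ss where "Ss = {S. S \<subseteq> G \<and> card S = K}"
  define C where "C = Sigma Ss (\<lambda>S. S \<rightarrow>\<^sub>E {..<K})"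
  define sat where "sat g c \<longleftrightarrow> (\<forall>x\<in>fst c. g x = snd c x)" for g and c :: "'g set \<times> ('g \<Rightarrow> nat)"
  have finSs: "finite Ss" using finG by (simp add: Ss_def)
  have finS: "finite S" if "S \<in> Ss" for S
    using that finG by (auto simp: Ss_def intro: finite_subset)
  have finC: "finite C"
    unfolding C_def using finSs finS by (auto intro!: finite_PiE)
  have finF: "finite F" using finG by (auto simp: F_def intro: finite_PiE)
  have "card C = (\<Sum>S\<in>Ss. K ^ card S)"
    unfolding C_def using finSs finS by (subst card_SigmaI) (auto intro!: finite_PiE sum.cong simp: card_PiE)
  also have "\<dots> = (card G choose K) * K ^ K"
    using finG by (simp add: Ss_def n_subsets)
  finally have cardC: "card C = (card G choose K) * K ^ K" .
  have "card C \<le> card G ^ K * K ^ K"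
  proof (cases "K \<le> card G")
    case True
    then show ?thesis using cardC binomial_le_pow[OF True] by simp
  next
    case False
    then show ?thesis using cardC by (simp add: binomial_eq_0)
  qed
  then have few: "real (card C) \<le> real (card G ^ K * K ^ K)"
    by (simp only: of_nat_le_iff)
  have dense: "1 / real (K ^ K) * real (card F) \<le> real (card {g \<in> F. sat g c})" if c: "c \<in> C" for c
  proof -
    obtain S p where Sp: "c = (S, p)" "S \<subseteq> G" "card S = K" "p \<in> S \<rightarrow>\<^sub>E {..<K}"
      using c by (auto simp: C_def Ss_def)
    have finS': "finite S" using Sp(2) finG by (rule finite_subset)
    define E where "E = Pi\<^sub>E G (\<lambda>x. if x \<in> S then {p x} else {..<K})"
    have "E \<subseteq> {g \<in> F. sat g c}"
    proof
      fix g assume g: "g \<in> E"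
      have "g \<in> F"
        unfolding F_def
      proof (rule PiE_I)
        fix x assume "x \<in> G"
        then have "g x \<in> (if x \<in> S then {p x} else {..<K})"
          using g unfolding E_def by (rule PiE_mem[rotated])
        moreover have "x \<in> S \<Longrightarrow> p x \<in> {..<K}" using Sp(4) by auto
        ultimately show "g x \<in> {..<K}" by (auto split: if_splits)
      next
        fix x assume "x \<notin> G"
        then show "g x = undefined" using g unfolding E_def by (rule PiE_arb[rotated])
      qed
      moreover have "g x = p x" if "x \<in> S" for x
        using PiE_mem[OF g[unfolded E_def], of x] that Sp(2) by auto
      ultimately show "g \<in> {g \<in> F. sat g c}" using Sp(1) by (auto simp: sat_def)
    qed
    then have "card E \<le> card {g \<in> F. sat g c}"
      using finF by (intro card_mono) auto
    moreover have "card E = (\<Prod>x\<in>G. if x \<in> S then 1 else K)"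
      unfolding E_def using finG by (auto simp: card_PiE intro!: prod.cong)
    moreover have "(\<Prod>x\<in>G. if x \<in> S then 1 else K) = K ^ card (G - S)"
      using finG by (simp add: prod.If_cases Diff_eq)
    moreover have "card F = K ^ card G"
      using finG by (simp add: F_def card_PiE)
    moreover have "card G = card (G - S) + K"
      using Sp finG finS' by (metis card_Diff_subset card_mono le_add_diff_inverse2)
    ultimately have "real (card F) = real (K ^ K) * real (card E)" "card E \<le> card {g \<in> F. sat g c}"
      by (simp_all add: power_add)
    then show ?thesis using K by simp
  qed
  have ne: "F \<noteq> {}" using K by (auto simp: F_def PiE_eq_empty_iff)
  have le1: "1 / real (K ^ K) \<le> 1" using K by (simp add: Suc_leI)
  obtain P where P: "P \<subseteq> F" "card P \<le> M"
    and rest: "real (card {c \<in> C. \<forall>g\<in>P. \<not> sat g c}) \<le> (1 - 1 / real (K ^ K)) ^ M * real (card C)"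
    using greedy_cover[where sat = sat and M = M, OF finF finC ne le1 dense] by blast
  have "(1 - 1 / real (K ^ K)) ^ M * real (card C)
      \<le> (1 - 1 / real (K ^ K)) ^ M * real (card G ^ K * K ^ K)"
    using few le1 by (intro mult_left_mono) auto
  with rest small have "card {c \<in> C. \<forall>g\<in>P. \<not> sat g c} = 0"
    by (simp add: mult.commute)
  then have all: "{c \<in> C. \<forall>g\<in>P. \<not> sat g c} = {}" using finC by simp
  have "\<exists>g\<in>P. \<forall>x\<in>S. g x = p x" if "S \<subseteq> G" "card S = K" "p \<in> S \<rightarrow> {..<K}" for S p
  proof -
    have "(S, restrict p S) \<in> C" using that by (auto simp: C_def Ss_def)
    then obtain g where "g \<in> P" "sat g (S, restrict p S)" using all by blast
    then show ?thesis by (auto simp: sat_def)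
  qed
  then have "pattern_universal K G P" using P(1) unfolding pattern_universal_def F_def by blast
  then show ?thesis using P(2) by blast
qed

text \<open>
  For fixed \<open>K\<close>, the number of constraints is at most \<open>2 ^ (e * m)\<close> for a constant \<open>e\<close>, and a bounded
  number \<open>d\<close> of greedy choices halves what is left.
\<close>
lemma universal_family_log:
  fixes K :: nat
  assumes K: "0 < K"
  shows "\<exists>D. \<forall>(G :: 'g set) m. finite G \<and> 0 < m \<and> card G \<le> 2 ^ m \<longrightarrow>
    (\<exists>P. pattern_universal K G P \<and> card P \<le> D * m)"
proof -
  define \<epsilon> where "\<epsilon> = 1 - 1 / real (K ^ K)"
  have \<epsilon>: "0 \<le> \<epsilon>" "\<epsilon> < 1" using K by (simp_all add: \<epsilon>_def Suc_leI)
  obtain d where d: "\<epsilon> ^ d < 1 / 2"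
    using real_arch_pow_inv[of "1 / 2" \<epsilon>] \<epsilon>(2) by auto
  define e where "e = K + K * K"
  have "real (card G ^ K * K ^ K) * \<epsilon> ^ (d * (e + 1) * m) < 1"
    if G: "card G \<le> 2 ^ m" "0 < m" for G :: "'g set" and m
  proof -
    have "card G ^ K * K ^ K \<le> (2 ^ m) ^ K * (2 ^ K) ^ K"
      using G by (intro mult_mono power_mono) (auto simp: less_imp_le)
    also have "\<dots> = 2 ^ (m * K + K * K)" by (simp add: power_mult power_add)
    also have "\<dots> \<le> (2::nat) ^ (e * m)"
      using G by (intro power_increasing) (auto simp: e_def algebra_simps)
    finally have "card G ^ K * K ^ K \<le> 2 ^ (e * m)" .
    then have 1: "real (card G ^ K * K ^ K) \<le> 2 ^ (e * m)"
      by (metis of_nat_le_iff of_nat_numeral of_nat_power)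
    have "\<epsilon> ^ (d * (e + 1) * m) = (\<epsilon> ^ d) ^ (e * m + m)"
      by (simp add: power_mult[symmetric] algebra_simps)
    also have "\<dots> \<le> (1 / 2) ^ (e * m + m)"
      using d \<epsilon> by (intro power_mono) auto
    finally have 2: "\<epsilon> ^ (d * (e + 1) * m) \<le> (1 / 2) ^ (e * m + m)" .
    have "real (card G ^ K * K ^ K) * \<epsilon> ^ (d * (e + 1) * m) \<le> 2 ^ (e * m) * (1 / 2) ^ (e * m + m)"
      using 1 2 \<epsilon> by (intro mult_mono) auto
    also have "\<dots> = (1 / 2) ^ m"
      by (simp add: power_add power_one_over)
    also have "\<dots> < 1" using G(2) by (simp add: power_less_one_iff)
    finally show ?thesis .
  qed
  then have "\<forall>(G :: 'g set) m. finite G \<and> 0 < m \<and> card G \<le> 2 ^ m \<longrightarrow>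
    (\<exists>P. pattern_universal K G P \<and> card P \<le> d * (e + 1) * m)"
    using universal_family[OF _ K] unfolding \<epsilon>_def by blast
  then show ?thesis by blast
qed

section \<open>Acyclic orientations of a union of cliques\<close>

text \<open>
  The sets in \<open>\<C>\<close> are cliques of a graph on the digits: each collects the children of one node of a
  prefix tree. A ranking \<open>f\<close> of the digits orients every edge towards the larger rank.
\<close>
definition orientation :: "nat set set \<Rightarrow> (nat \<Rightarrow> nat) \<Rightarrow> nat rel" where
  "orientation \<C> f = {(a, b). (\<exists>C\<in>\<C>. a \<in> C \<and> b \<in> C) \<and> f a < f b}"

definition orientations :: "nat set set \<Rightarrow> nat rel set" where
  "orientations \<C> = orientation \<C> ` {f. inj_on f (\<Union>\<C>)}"

lemma finite_orientations:
  assumes "finite (\<Union>\<C>)"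
  shows "finite (orientations \<C>)"
  by (rule finite_subset[of _ "Pow (\<Union>\<C> \<times> \<Union>\<C>)"])
     (use assms in \<open>auto simp: orientations_def orientation_def\<close>)

lemma orientations_pos: "finite (\<Union>\<C>) \<Longrightarrow> 1 \<le> card (orientations \<C>)"
proof -
  assume fin: "finite (\<Union>\<C>)"
  have "orientation \<C> id \<in> orientations \<C>" by (auto simp: orientations_def)
  then show ?thesis
    using finite_orientations[OF fin] by (metis One_nat_def Suc_leI card_gt_0_iff empty_iff)
qed

text \<open>
  The rankings that witness all lower bounds below: the digits up to \<open>B\<close> in increasing or decreasing
  order, except that \<open>c\<close> is moved to the very bottom or the very top.
\<close>
definition pinned :: "nat \<Rightarrow> nat \<Rightarrow> bool \<Rightarrow> bool \<Rightarrow> nat \<Rightarrow> nat" where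
  "pinned B c low up v =
     (if v = c then (if low then 0 else B + 2) else if up then v + 1 else B + 1 - v)"

lemma orientation_pinned:
  assumes "\<And>v. v \<in> \<Union>\<C> \<Longrightarrow> v \<le> B"
  shows "orientation \<C> (pinned B c low up) \<in> orientations \<C>"
proof -
  have "inj_on (pinned B c low up) (\<Union>\<C>)"
    by (rule inj_onI) (use assms in \<open>fastforce simp: pinned_def split: if_splits\<close>)
  then show ?thesis by (auto simp: orientations_def)
qed

lemma orientation_pinned_top_iff:
  assumes "C \<in> \<C>" "c \<in> C" "b \<in> C" "b \<noteq> c" "b \<le> B"
  shows "(c, b) \<in> orientation \<C> (pinned B c low up) \<longleftrightarrow> low"
  using assms by (auto simp: orientation_def pinned_def)

lemma orientation_pinned_bot_iff:
  assumes "C \<in> \<C>" "c \<in> C" "b \<in> C" "b \<noteq> c" "b \<le> B"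
  shows "(b, c) \<in> orientation \<C> (pinned B c low up) \<longleftrightarrow> \<not> low"
  using assms by (auto simp: orientation_def pinned_def)

lemma orientation_pinned_up_iff:
  assumes "C \<in> \<C>" "a \<in> C" "b \<in> C" "a < b" "a \<noteq> c" "b \<noteq> c" "b \<le> B"
  shows "(a, b) \<in> orientation \<C> (pinned B c low up) \<longleftrightarrow> up"
  using assms by (auto simp: orientation_def pinned_def)

text \<open>
  Choosing which digit of the clique comes first, and whether the others increase or decrease, gives
  \<open>2 * card C\<close> orientations. Two other digits are needed to tell increasing from decreasing,
  hence the bound on the size of the clique.
\<close>
lemma orientations_clique:
  assumes fin: "finite (\<Union>\<C>)" and C: "C \<in> \<C>" "3 \<le> card C"
  shows "2 * card C \<le> card (orientations \<C>)"
proof -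
  define B where "B = Max (\<Union>\<C>)"
  have B: "v \<le> B" if "v \<in> \<Union>\<C>" for v using fin that by (simp add: B_def)
  have BC: "v \<le> B" if "v \<in> C" for v using B that C by blast
  have finC: "finite C" using fin C(1) by (meson Union_upper finite_subset)
  define \<phi> where "\<phi> = (\<lambda>(c, up). orientation \<C> (pinned B c True up))"
  have "inj_on \<phi> (C \<times> UNIV)"
  proof (rule inj_onI, clarify)
    fix c up c' up'
    assume cc: "c \<in> C" "c' \<in> C" and eq: "\<phi> (c, up) = \<phi> (c', up')"
    have c: "c = c'"
    proof (rule ccontr)
      assume ne: "c \<noteq> c'"
      have "(c, c') \<in> \<phi> (c, up)"
        using orientation_pinned_top_iff[of C \<C> c c' B] ne cc C BC by (auto simp: \<phi>_def)
      moreover have "(c, c') \<notin> \<phi> (c', up')"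
        using orientation_pinned_bot_iff[of C \<C> c' c B] ne cc C BC by (auto simp: \<phi>_def)
      ultimately show False using eq by simp
    qed
    have "2 \<le> card (C - {c})" using C cc finC by simp
    then obtain a b where ab: "a \<in> C - {c}" "b \<in> C - {c}" "a \<noteq> b"
      by (metis card_le_Suc0_iff_eq finC finite_Diff not_less_eq_eq numeral_2_eq_2)
    define x y where "x = min a b" and "y = max a b"
    have xy: "x \<in> C" "y \<in> C" "x < y" "x \<noteq> c" "y \<noteq> c"
      using ab by (auto simp: x_def y_def min_def max_def)
    have "(x, y) \<in> \<phi> (c, u) \<longleftrightarrow> u" for u
      using orientation_pinned_up_iff[of C \<C> x y c B] xy C BC by (auto simp: \<phi>_def)
    then show "c = c' \<and> up = up'" using eq c by metis
  qed
  moreover have "\<phi> ` (C \<times> UNIV) \<subseteq> orientations \<C>"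
    using orientation_pinned[OF B] by (auto simp: \<phi>_def)
  ultimately have "card (C \<times> (UNIV :: bool set)) \<le> card (orientations \<C>)"
    using card_inj_on_le finite_orientations[OF fin] by blast
  then show ?thesis by (simp add: card_cartesian_product mult.commute)
qed

lemma card_bool_pairs: "card (UNIV :: (bool \<times> bool) set) = 4"
  by (simp add: UNIV_Times_UNIV[symmetric] card_cartesian_product del: UNIV_Times_UNIV)

text \<open>
  Some endpoint \<open>y\<close> of \<open>D\<close> lies outside \<open>C\<close>. Pinning \<open>y\<close> to the bottom or the top orients \<open>D\<close> both ways,
  independently of the orientation of \<open>C\<close>.
\<close>
lemma orientations_two_edges:
  assumes fin: "finite (\<Union>\<C>)" and C: "C \<in> \<C>" "card C = 2" and D: "D \<in> \<C>" "card D = 2"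
    and ne: "C \<noteq> D"
  shows "4 \<le> card (orientations \<C>)"
proof -
  define B where "B = Max (\<Union>\<C>)"
  have B: "v \<le> B" if "v \<in> \<Union>\<C>" for v using fin that by (simp add: B_def)
  obtain a b where ab: "C = {a, b}" "a < b"
    using C(2) by (metis card_2_iff insert_commute linorder_neqE_nat)
  have "\<not> D \<subseteq> C"
    using ne C(2) D(2) by (metis card_subset_eq card.infinite zero_neq_numeral)
  then obtain y where y: "y \<in> D" "y \<notin> C" by blast
  obtain x where x: "x \<in> D" "x \<noteq> y" using D(2) y(1) by (auto simp: card_2_iff)
  define \<phi> where "\<phi> = (\<lambda>(low, up). orientation \<C> (pinned B y low up))"
  have low: "(y, x) \<in> \<phi> (l, u) \<longleftrightarrow> l" for l u
    using orientation_pinned_top_iff[of D \<C> y x B] x y D(1) B by (auto simp: \<phi>_def)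
  have up: "(a, b) \<in> \<phi> (l, u) \<longleftrightarrow> u" for l u
    using orientation_pinned_up_iff[of C \<C> a b y B l u] ab y C(1) B[of b] by (auto simp: \<phi>_def)
  have "inj \<phi>"
  proof (rule injI, clarify)
    fix l u l' u' assume "\<phi> (l, u) = \<phi> (l', u')"
    then show "l = l' \<and> u = u'" using low[of l u] low[of l' u'] up[of l u] up[of l' u'] by simp
  qed
  moreover have "range \<phi> \<subseteq> orientations \<C>"
    using orientation_pinned[OF B] by (auto simp: \<phi>_def)
  ultimately have "card (UNIV :: (bool \<times> bool) set) \<le> card (orientations \<C>)"
    using card_inj_on_le finite_orientations[OF fin] by blast
  then show ?thesis by (simp add: card_bool_pairs)
qed

lemma orientations_edge:
  assumes fin: "finite (\<Union>\<C>)" and C: "C \<in> \<C>" "card C = 2"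
  shows "2 \<le> card (orientations \<C>)"
proof -
  define B where "B = Max (\<Union>\<C>)"
  have B: "v \<le> B" if "v \<in> \<Union>\<C>" for v using fin that by (simp add: B_def)
  obtain a b where ab: "C = {a, b}" "a \<noteq> b" using C(2) by (auto simp: card_2_iff)
  define \<phi> where "\<phi> low = orientation \<C> (pinned B a low True)" for low
  have low: "(a, b) \<in> \<phi> l \<longleftrightarrow> l" for l
    using orientation_pinned_top_iff[of C \<C> a b B l True] ab C(1) B[of b] by (auto simp: \<phi>_def)
  have "inj \<phi>" by (rule injI) (metis low)
  moreover have "range \<phi> \<subseteq> orientations \<C>"
    using orientation_pinned[OF B] by (auto simp: \<phi>_def)
  ultimately have "card (UNIV :: bool set) \<le> card (orientations \<C>)"
    using card_inj_on_le finite_orientations[OF fin] by blast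
  then show ?thesis by simp
qed

text \<open>
  The second alternative describes a graph without edges, which has one orientation, and a graph with
  a single edge, which has two. In these two cases the factor \<open>2\<close> cannot be gained.
\<close>
lemma orientations_dichotomy:
  assumes fin: "finite \<C>" "\<And>C. C \<in> \<C> \<Longrightarrow> finite C" and ne: "\<C> \<noteq> {}" "{} \<notin> \<C>"
  defines "q \<equiv> Max (card ` \<C>)"
  shows "q \<le> card (orientations \<C>)"
    and "2 * q \<le> card (orientations \<C>) \<or>
      q \<in> {1, 2} \<and> (\<forall>C\<in>\<C>. \<forall>D\<in>\<C>. card C = 2 \<and> card D = 2 \<longrightarrow> C = D)"
proof -
  have finU: "finite (\<Union>\<C>)" using fin by blast
  have "q \<in> card ` \<C>" using fin ne by (auto simp: q_def)
  then obtain C where C: "C \<in> \<C>" "card C = q" by blast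
  have q: "q \<ge> 1" using C fin(2)[OF C(1)] ne by (metis One_nat_def Suc_leI card_gt_0_iff)
  consider "q = 1" | "q = 2" | "3 \<le> q" using q by linarith
  then have "q \<le> card (orientations \<C>) \<and> (2 * q \<le> card (orientations \<C>) \<or>
      q \<in> {1, 2} \<and> (\<forall>C\<in>\<C>. \<forall>D\<in>\<C>. card C = 2 \<and> card D = 2 \<longrightarrow> C = D))"
  proof cases
    case 1
    have "card D \<le> 1" if "D \<in> \<C>" for D
      using that fin 1 by (metis Max_ge finite_imageI imageI q_def)
    then show ?thesis using 1 orientations_pos[OF finU] by fastforce
  next
    case 2
    then show ?thesis
      using orientations_edge[OF finU C(1)] orientations_two_edges[OF finU] C by fastforce
  next
    case 3
    then show ?thesis using orientations_clique[OF finU C(1)] C by force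
  qed
  then show "q \<le> card (orientations \<C>)"
    and "2 * q \<le> card (orientations \<C>) \<or>
      q \<in> {1, 2} \<and> (\<forall>C\<in>\<C>. \<forall>D\<in>\<C>. card C = 2 \<and> card D = 2 \<longrightarrow> C = D)" by auto
qed


section \<open>Lexicographic orders on coded points\<close>

text \<open>
  Position \<open>0\<close> is the most significant one. The elements of \<open>A\<close> are natural numbers only so that they
  carry an order to break ties with.
\<close>
locale digit_code =
  fixes A :: "nat set" and c :: "nat \<Rightarrow> nat \<Rightarrow> nat" and m N :: nat
  assumes finite_A: "finite A"
    and digit_less: "\<lbrakk>x \<in> A; i < m\<rbrakk> \<Longrightarrow> c x i < N"
    and digits_inj: "\<lbrakk>x \<in> A; y \<in> A; \<forall>i<m. c x i = c y i\<rbrakk> \<Longrightarrow> x = y"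
begin

definition agree :: "nat \<Rightarrow> nat \<Rightarrow> nat \<Rightarrow> bool" where
  "agree i x y \<longleftrightarrow> (\<forall>j<i. c x j = c y j)"

lemma agree_0 [simp]: "agree 0 x y" by (simp add: agree_def)

lemma agree_Suc: "agree (Suc i) x y \<longleftrightarrow> agree i x y \<and> c x i = c y i"
  by (auto simp: agree_def less_Suc_eq)

lemma agree_refl [simp]: "agree i x x" by (simp add: agree_def)

lemma agree_sym: "agree i x y \<Longrightarrow> agree i y x" by (simp add: agree_def)

lemma agree_trans: "agree i x y \<Longrightarrow> agree i y z \<Longrightarrow> agree i x z" by (simp add: agree_def)

lemma agree_mono: "agree i x y \<Longrightarrow> j \<le> i \<Longrightarrow> agree j x y" by (simp add: agree_def)

lemma first_difference_unique:
  assumes "agree i x y" "c x i \<noteq> c y i" "agree j x y" "c x j \<noteq> c y j"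
  shows "i = j"
  using assms unfolding agree_def by (metis linorder_neqE_nat)

lemma first_difference:
  assumes "\<not> agree n x y"
  obtains i where "i < n" "agree i x y" "c x i \<noteq> c y i"
proof -
  define i where "i = (LEAST i. c x i \<noteq> c y i)"
  obtain j where j: "j < n" "c x j \<noteq> c y j" using assms by (auto simp: agree_def)
  have "c x i \<noteq> c y i" unfolding i_def by (rule LeastI[of "\<lambda>i. c x i \<noteq> c y i", OF j(2)])
  moreover have "i < n" using j Least_le[of "\<lambda>i. c x i \<noteq> c y i", OF j(2)] by (simp add: i_def)
  moreover have "agree i x y" using not_less_Least by (fastforce simp: agree_def i_def)
  ultimately show ?thesis using that by blast
qed

lemma not_agree_m: "\<lbrakk>x \<in> A; y \<in> A; x \<noteq> y\<rbrakk> \<Longrightarrow> \<not> agree m x y"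
  using digits_inj by (auto simp: agree_def)

text \<open>
  The order of the alphabet at position \<open>i\<close> is given by the ranking \<open>h i\<close>.
\<close>
definition lex_order :: "(nat \<Rightarrow> nat \<Rightarrow> nat) \<Rightarrow> nat rel" where
  "lex_order h = {(x, y) \<in> A \<times> A. \<exists>i<m. agree i x y \<and> h i (c x i) < h i (c y i)}"

lemma lex_order_iff:
  assumes "x \<in> A" "y \<in> A" "i < m" "agree i x y" "c x i \<noteq> c y i"
  shows "(x, y) \<in> lex_order h \<longleftrightarrow> h i (c x i) < h i (c y i)"
proof
  assume "(x, y) \<in> lex_order h"
  then obtain j where j: "agree j x y" "h j (c x j) < h j (c y j)" by (auto simp: lex_order_def)
  then have "c x j \<noteq> c y j" by auto
  then have "i = j" by (rule first_difference_unique[OF assms(4,5) j(1)])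
  then show "h i (c x i) < h i (c y i)" using j(2) by simp
next
  assume "h i (c x i) < h i (c y i)"
  then show "(x, y) \<in> lex_order h" using assms(1-4) by (auto simp: lex_order_def)
qed

lemma lex_order_perm:
  assumes inj: "\<And>i. i < m \<Longrightarrow> inj_on (h i) {..<N}"
  shows "lex_order h \<in> perms_on A"
proof -
  have "trans (lex_order h)"
  proof (rule transI)
    fix x y z assume "(x, y) \<in> lex_order h" "(y, z) \<in> lex_order h"
    then obtain i j where mem: "x \<in> A" "z \<in> A"
      and i: "i < m" "agree i x y" "h i (c x i) < h i (c y i)"
      and j: "j < m" "agree j y z" "h j (c y j) < h j (c z j)"
      by (auto simp: lex_order_def)
    define l where "l = min i j"
    have "l < m" using i j by (simp add: l_def)
    moreover have "agree l x z"
      using i(2) j(2) agree_mono agree_trans by (metis l_def min.cobounded1 min.cobounded2)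
    moreover have "h l (c x l) < h l (c z l)"
    proof (cases i j rule: linorder_cases)
      case less
      then have "c y i = c z i" using j(2) by (simp add: agree_def)
      then show ?thesis using i less by (simp add: l_def)
    next
      case equal
      then show ?thesis using i j by (simp add: l_def)
    next
      case greater
      then have "c x j = c y j" using i(2) by (simp add: agree_def)
      then show ?thesis using j greater by (simp add: l_def)
    qed
    ultimately show "(x, z) \<in> lex_order h" using mem by (auto simp: lex_order_def)
  qed
  moreover have "irrefl (lex_order h)" by (auto simp: irrefl_def lex_order_def)
  moreover have "total_on A (lex_order h)"
  proof (rule total_onI)
    fix x y assume xy: "x \<in> A" "y \<in> A" "x \<noteq> y"
    obtain i where i: "i < m" "agree i x y" "c x i \<noteq> c y i"
      using first_difference[OF not_agree_m[OF xy]] .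
    have "h i (c x i) \<noteq> h i (c y i)"
      using inj[OF i(1)] i xy digit_less by (auto dest: inj_onD)
    then show "(x, y) \<in> lex_order h \<or> (y, x) \<in> lex_order h"
      using lex_order_iff[OF xy(1,2) i] lex_order_iff[OF xy(2,1) i(1) agree_sym[OF i(2)]] i(3)
      by force
  qed
  ultimately show ?thesis
    by (auto simp: perms_on_def strict_linear_order_on_def lex_order_def)
qed

text \<open>
  The rankings only have to separate the digits that occur in \<open>X\<close>, since all that matters here is the
  induced order.
\<close>
definition lex_orders :: "nat set \<Rightarrow> nat rel set" where
  "lex_orders X =
     (\<lambda>h. Restr (lex_order h) X) ` {h. \<forall>i<m. inj_on (h i) ((\<lambda>x. c x i) ` X)}"

text \<open>
  The classes are the nodes at depth \<open>i\<close> of the prefix tree of \<open>X\<close>, each given by the set of leaves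
  below it.
\<close>
definition classes :: "nat set \<Rightarrow> nat \<Rightarrow> nat set set" where
  "classes X i = (\<lambda>x. {y \<in> X. agree i x y}) ` X"

definition child_digits :: "nat set \<Rightarrow> nat \<Rightarrow> nat set set" where
  "child_digits X i = (\<lambda>Z. (\<lambda>y. c y i) ` Z) ` classes X i"

lemma Union_child_digits: "\<Union>(child_digits X i) = (\<lambda>x. c x i) ` X"
  by (auto simp: child_digits_def classes_def)

lemma finite_classes: "X \<subseteq> A \<Longrightarrow> finite (classes X i)"
  using finite_A by (auto simp: classes_def intro: finite_subset)

lemma finite_class: "X \<subseteq> A \<Longrightarrow> Z \<in> classes X i \<Longrightarrow> finite Z"
  using finite_A by (auto simp: classes_def intro: finite_subset)

lemma class_nonempty: "Z \<in> classes X i \<Longrightarrow> Z \<noteq> {}"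
  by (auto simp: classes_def)

lemma classes_agree: "\<lbrakk>Z \<in> classes X i; x \<in> Z; y \<in> Z\<rbrakk> \<Longrightarrow> x \<in> X \<and> y \<in> X \<and> agree i x y"
  by (auto simp: classes_def intro: agree_trans agree_sym)

lemma classes_eq:
  assumes "Z \<in> classes X i" "Z' \<in> classes X i" "x \<in> Z" "y \<in> Z'" "agree i x y"
  shows "Z = Z'"
proof -
  obtain u u' where u: "Z = {v \<in> X. agree i u v}" "Z' = {v \<in> X. agree i u' v}"
    using assms(1,2) by (auto simp: classes_def)
  then have "agree i u x" "agree i u' y" using assms(3,4) by auto
  then have "agree i u v \<longleftrightarrow> agree i u' v" for v
    using assms(5) by (meson agree_sym agree_trans)
  then show ?thesis using u by simp
qed

text \<open>
  An order induced by \<open>h\<close> determines the orientation at each position \<open>i\<close>: two digits joined by an edge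
  are compared in the same way as two points that have these digits as their first difference. As \<open>h\<close>
  is arbitrary at each position separately, every tuple of orientations arises.
\<close>
lemma prod_orientations_le_lex_orders:
  assumes X: "X \<subseteq> A"
  shows "(\<Prod>i<m. card (orientations (child_digits X i))) \<le> card (lex_orders X)"
proof -
  define \<Phi> where "\<Phi> r = (\<lambda>i\<in>{..<m}. {(c x i, c y i) | x y. (x, y) \<in> r \<and> agree i x y \<and> c x i \<noteq> c y i})"
    for r
  have finX: "finite X" using X finite_A by (rule finite_subset)
  have \<Phi>: "\<Phi> (Restr (lex_order h) X) i = orientation (child_digits X i) (h i)" if i: "i < m" for h i
  proof (intro set_eqI iffI; clarify)
    fix a b assume "(a, b) \<in> \<Phi> (Restr (lex_order h) X) i"
    then obtain x y where xy: "a = c x i" "b = c y i" "(x, y) \<in> lex_order h" "x \<in> X" "y \<in> X"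
      "agree i x y" "c x i \<noteq> c y i"
      using i by (auto simp: \<Phi>_def)
    define C where "C = (\<lambda>y. c y i) ` {y \<in> X. agree i x y}"
    have "h i a < h i b"
      using lex_order_iff[of x y i h] xy X i by auto
    moreover have "C \<in> child_digits X i"
      using xy(4) by (simp add: C_def child_digits_def classes_def)
    moreover have "a \<in> C" "b \<in> C" using xy by (auto simp: C_def)
    ultimately show "(a, b) \<in> orientation (child_digits X i) (h i)"
      by (auto simp: orientation_def)
  next
    fix a b assume "(a, b) \<in> orientation (child_digits X i) (h i)"
    then obtain C where C: "C \<in> child_digits X i" "a \<in> C" "b \<in> C" and lt: "h i a < h i b"
      by (auto simp: orientation_def)
    then obtain Z where "Z \<in> classes X i" "C = (\<lambda>y. c y i) ` Z"
      by (auto simp: child_digits_def)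
    with C obtain x y where Z: "Z \<in> classes X i" "x \<in> Z" "y \<in> Z" "a = c x i" "b = c y i"
      by blast
    have xy: "x \<in> X" "y \<in> X" "agree i x y" using classes_agree[OF Z(1-3)] by auto
    have ne: "c x i \<noteq> c y i" using Z lt by auto
    have "(x, y) \<in> Restr (lex_order h) X"
      using lex_order_iff[of x y i h] X i xy ne lt Z by auto
    then show "(a, b) \<in> \<Phi> (Restr (lex_order h) X) i"
      using i xy ne unfolding \<Phi>_def Z by auto
  qed
  have "Pi\<^sub>E {..<m} (\<lambda>i. orientations (child_digits X i)) \<subseteq> \<Phi> ` lex_orders X"
  proof
    fix F assume F: "F \<in> Pi\<^sub>E {..<m} (\<lambda>i. orientations (child_digits X i))"
    have "\<forall>i\<in>{..<m}. \<exists>f. inj_on f ((\<lambda>x. c x i) ` X) \<and> F i = orientation (child_digits X i) f"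
    proof
      fix i assume "i \<in> {..<m}"
      with F have "F i \<in> orientations (child_digits X i)" by (rule PiE_mem)
      then show "\<exists>f. inj_on f ((\<lambda>x. c x i) ` X) \<and> F i = orientation (child_digits X i) f"
        by (auto simp: orientations_def Union_child_digits)
    qed
    then obtain h where h: "\<forall>i\<in>{..<m}. inj_on (h i) ((\<lambda>x. c x i) ` X) \<and> F i = orientation (child_digits X i) (h i)"
      by (auto simp: bchoice_iff)
    have "F = \<Phi> (Restr (lex_order h) X)"
    proof (rule ext)
      fix i
      show "F i = \<Phi> (Restr (lex_order h) X) i"
      proof (cases "i < m")
        case True
        then show ?thesis using \<Phi>[OF True] h by simp
      next
        case False
        then show ?thesis using PiE_arb[OF F, of i] by (simp add: \<Phi>_def)
      qed
    qed
    moreover have "Restr (lex_order h) X \<in> lex_orders X"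
      using h by (auto simp: lex_orders_def)
    ultimately show "F \<in> \<Phi> ` lex_orders X" by blast
  qed
  moreover have "finite (lex_orders X)"
    by (rule finite_subset[of _ "Pow (X \<times> X)"]) (use finX in \<open>auto simp: lex_orders_def\<close>)
  ultimately have "card (Pi\<^sub>E {..<m} (\<lambda>i. orientations (child_digits X i))) \<le> card (lex_orders X)"
    by (intro surj_card_le)
  then show ?thesis by (simp add: card_PiE)
qed

section \<open>Counting lexicographic orders against points\<close>

definition max_branching :: "nat set \<Rightarrow> nat \<Rightarrow> nat" where
  "max_branching X i = Max (card ` child_digits X i)"

text \<open>
  Two different nodes at depth \<open>j\<close> branch into the same two digits. The points \<open>x1, x2\<close> lie below the
  first node and \<open>y1, y2\<close> below the second.
\<close>
definition twin_branching :: "nat set \<Rightarrow> bool" where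
  "twin_branching X \<longleftrightarrow> (\<exists>j<m. \<exists>x1\<in>X. \<exists>x2\<in>X. \<exists>y1\<in>X. \<exists>y2\<in>X.
     agree j x1 x2 \<and> agree j y1 y2 \<and> \<not> agree j x1 y1 \<and>
     c x1 j = c y1 j \<and> c x2 j = c y2 j \<and> c x1 j \<noteq> c x2 j)"

lemma card_class_digits_le:
  assumes "X \<subseteq> A" "Z \<in> classes X i"
  shows "card ((\<lambda>y. c y i) ` Z) \<le> max_branching X i"
proof -
  have "finite (card ` child_digits X i)"
    using finite_classes[OF assms(1)] by (simp add: child_digits_def)
  moreover have "(\<lambda>y. c y i) ` Z \<in> child_digits X i"
    using assms(2) unfolding child_digits_def by (rule imageI)
  ultimately show ?thesis unfolding max_branching_def by (intro Max_ge imageI)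
qed

lemma card_classes_0: "X \<noteq> {} \<Longrightarrow> card (classes X 0) = 1"
  by (simp add: classes_def image_constant_conv)

lemma card_classes_m:
  assumes "X \<subseteq> A"
  shows "card (classes X m) = card X"
proof -
  have "{y \<in> X. agree m x y} = {x}" if "x \<in> X" for x
    using that assms not_agree_m[of x] by auto
  then have "classes X m = (\<lambda>x. {x}) ` X" by (simp add: classes_def)
  then show ?thesis by (simp add: card_image)
qed

lemma card_classes_Suc:
  assumes X: "X \<subseteq> A"
  shows "card (classes X (Suc i)) \<le> (\<Sum>Z\<in>classes X i. card ((\<lambda>y. c y i) ` Z))"
proof -
  let ?split = "\<lambda>Z. (\<lambda>a. {y \<in> Z. c y i = a}) ` ((\<lambda>y. c y i) ` Z)"
  have "classes X (Suc i) \<subseteq> (\<Union>Z\<in>classes X i. ?split Z)"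
  proof
    fix Z' assume "Z' \<in> classes X (Suc i)"
    then obtain x where x: "x \<in> X" "Z' = {y \<in> X. agree (Suc i) x y}" by (auto simp: classes_def)
    let ?Z = "{y \<in> X. agree i x y}"
    have "Z' = {y \<in> ?Z. c y i = c x i}" using x by (auto simp: agree_Suc)
    then have "Z' \<in> ?split ?Z" using x(1) by auto
    then show "Z' \<in> (\<Union>Z\<in>classes X i. ?split Z)" using x(1) by (auto simp: classes_def)
  qed
  then have "card (classes X (Suc i)) \<le> card (\<Union>Z\<in>classes X i. ?split Z)"
    using finite_classes[OF X] finite_class[OF X] by (intro card_mono) auto
  also have "\<dots> \<le> (\<Sum>Z\<in>classes X i. card (?split Z))"
    by (rule card_UN_le[OF finite_classes[OF X]])
  also have "\<dots> \<le> (\<Sum>Z\<in>classes X i. card ((\<lambda>y. c y i) ` Z))"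
    using finite_class[OF X] by (intro sum_mono card_image_le) auto
  finally show ?thesis .
qed

lemma card_classes_le_prod:
  assumes X: "X \<subseteq> A" "X \<noteq> {}"
  shows "card (classes X i) \<le> (\<Prod>j<i. max_branching X j)"
proof (induction i)
  case 0
  then show ?case using card_classes_0[OF X(2)] by simp
next
  case (Suc i)
  have "card (classes X (Suc i)) \<le> (\<Sum>Z\<in>classes X i. max_branching X i)"
    using card_classes_Suc[OF X(1), of i] card_class_digits_le[OF X(1), of _ i]
    by (meson order_trans sum_mono)
  also have "\<dots> \<le> (\<Prod>j<i. max_branching X j) * max_branching X i"
    using Suc by simp
  finally show ?case by simp
qed

lemma max_branching_le_orientations:
  assumes X: "X \<subseteq> A" "X \<noteq> {}"
  shows "max_branching X i \<le> card (orientations (child_digits X i))"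
    and "2 * max_branching X i \<le> card (orientations (child_digits X i)) \<or>
      max_branching X i \<in> {1, 2} \<and>
      (\<forall>C\<in>child_digits X i. \<forall>D\<in>child_digits X i. card C = 2 \<and> card D = 2 \<longrightarrow> C = D)"
proof -
  have 1: "finite (child_digits X i)" "{} \<notin> child_digits X i"
    using finite_classes[OF X(1)] class_nonempty by (auto simp: child_digits_def)
  have 2: "child_digits X i \<noteq> {}" using X(2) by (auto simp: child_digits_def classes_def)
  have 3: "finite C" if "C \<in> child_digits X i" for C
    using that finite_class[OF X(1)] by (auto simp: child_digits_def)
  show "max_branching X i \<le> card (orientations (child_digits X i))"
    and "2 * max_branching X i \<le> card (orientations (child_digits X i)) \<or>
      max_branching X i \<in> {1, 2} \<and>
      (\<forall>C\<in>child_digits X i. \<forall>D\<in>child_digits X i. card C = 2 \<and> card D = 2 \<longrightarrow> C = D)"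
    using orientations_dichotomy[OF 1(1) 3 2 1(2)] by (auto simp: max_branching_def)
qed

text \<open>
  As all branching nodes at a position have the same two children, two of them would be twins. So at
  most one node of each depth branches, and it adds a single class.
\<close>
lemma card_classes_le_without_twins:
  assumes X: "X \<subseteq> A" "X \<noteq> {}" and no_twins: "\<not> twin_branching X"
    and binary: "\<And>i. i < m \<Longrightarrow> max_branching X i \<in> {1, 2} \<and>
      (\<forall>C\<in>child_digits X i. \<forall>D\<in>child_digits X i. card C = 2 \<and> card D = 2 \<longrightarrow> C = D)"
  shows "i \<le> m \<Longrightarrow> card (classes X i) \<le> 1 + card {j. j < i \<and> max_branching X j = 2}"
proof (induction i)
  case 0
  then show ?case using card_classes_0[OF X(2)] by simp
next
  case (Suc i)
  then have i: "i < m" by simp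
  let ?d = "\<lambda>Z. card ((\<lambda>y. c y i) ` Z)"
  have fin: "finite (classes X i)" using finite_classes[OF X(1)] .
  show ?case
  proof (cases "max_branching X i = 2")
    case False
    then have "?d Z \<le> 1" if "Z \<in> classes X i" for Z
      using binary[OF i] card_class_digits_le[OF X(1) that] by auto
    then have "card (classes X (Suc i)) \<le> card (classes X i)"
      using card_classes_Suc[OF X(1), of i] sum_mono[of "classes X i" ?d "\<lambda>_. 1"] by simp
    moreover have "{j. j < Suc i \<and> max_branching X j = 2} = {j. j < i \<and> max_branching X j = 2}"
      using False by (auto simp: less_Suc_eq)
    ultimately show ?thesis using Suc by simp
  next
    case True
    have unique: "Z = Z'" if Z: "Z \<in> classes X i" "?d Z = 2" and Z': "Z' \<in> classes X i" "?d Z' = 2" for Z Z'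
    proof (rule ccontr)
      assume ne: "Z \<noteq> Z'"
      have eq: "(\<lambda>y. c y i) ` Z = (\<lambda>y. c y i) ` Z'"
        using binary[OF i] Z Z' by (auto simp: child_digits_def)
      obtain a b where ab: "(\<lambda>y. c y i) ` Z = {a, b}" "a \<noteq> b"
        using Z(2) by (auto simp: card_2_iff)
      obtain x1 x2 where x: "x1 \<in> Z" "x2 \<in> Z" "c x1 i = a" "c x2 i = b"
        using ab by (metis imageE insertI1 insertI2 singletonI)
      obtain y1 y2 where y: "y1 \<in> Z'" "y2 \<in> Z'" "c y1 i = a" "c y2 i = b"
        using ab eq by (metis imageE insertI1 insertI2 singletonI)
      have "\<not> agree i x1 y1" using classes_eq[OF Z(1) Z'(1) x(1) y(1)] ne by blast
      then show False
        using no_twins i x y ab(2) classes_agree[OF Z(1) x(1,2)] classes_agree[OF Z'(1) y(1,2)]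
        unfolding twin_branching_def by metis
    qed
    have "?d Z \<le> 1 + (if ?d Z = 2 then 1 else 0)" if "Z \<in> classes X i" for Z
      using card_class_digits_le[OF X(1) that] True by auto
    then have "(\<Sum>Z\<in>classes X i. ?d Z) \<le> (\<Sum>Z\<in>classes X i. 1 + (if ?d Z = 2 then 1 else 0))"
      by (intro sum_mono) auto
    also have "\<dots> = card (classes X i) + card {Z \<in> classes X i. ?d Z = 2}"
      unfolding sum.distrib using fin by (simp add: sum.If_cases Int_def)
    also have "card {Z \<in> classes X i. ?d Z = 2} \<le> 1"
      using fin unique by (simp add: card_le_Suc0_iff_eq)
    finally have "card (classes X (Suc i)) \<le> card (classes X i) + 1"
      using card_classes_Suc[OF X(1), of i] by linarith
    moreover have "{j. j < Suc i \<and> max_branching X j = 2} = insert i {j. j < i \<and> max_branching X j = 2}"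
      using True by (auto simp: less_Suc_eq)
    ultimately show ?thesis using Suc by simp
  qed
qed

text \<open>
  One position with \<open>2 * q\<close> orientations suffices for \<open>2 * card X\<close> orders. If there is none, both
  products are compared with \<open>2 ^ b\<close>, where \<open>b\<close> counts the positions with a branching node.
\<close>
lemma lex_orders_many_or_twins:
  assumes X: "X \<subseteq> A" "4 \<le> card X"
  shows "2 * card X \<le> card (lex_orders X) \<or>
    twin_branching X \<and> (\<exists>b. card X \<le> 2 ^ b \<and> 2 ^ b \<le> card (lex_orders X))"
proof -
  have ne: "X \<noteq> {}" using X(2) by auto
  let ?a = "\<lambda>i. card (orientations (child_digits X i))"
  let ?q = "max_branching X"
  note q = max_branching_le_orientations[OF X(1) ne]
  have prod_q: "card X \<le> (\<Prod>i<m. ?q i)"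
    using card_classes_le_prod[OF X(1) ne, of m] card_classes_m[OF X(1)] by simp
  have prod_a: "(\<Prod>i<m. ?a i) \<le> card (lex_orders X)"
    by (rule prod_orientations_le_lex_orders[OF X(1)])
  show ?thesis
  proof (cases "\<exists>i<m. 2 * ?q i \<le> ?a i")
    case True
    then obtain i where i: "i < m" "2 * ?q i \<le> ?a i" by blast
    have "2 * (\<Prod>i<m. ?q i) = 2 * ?q i * (\<Prod>j\<in>{..<m} - {i}. ?q j)"
      using i(1) by (subst prod.remove[of _ i]) auto
    also have "\<dots> \<le> ?a i * (\<Prod>j\<in>{..<m} - {i}. ?a j)"
      using i(2) q(1) by (intro mult_mono prod_mono) auto
    also have "\<dots> = (\<Prod>i<m. ?a i)"
      using i(1) by (subst (2) prod.remove[of _ i]) auto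
    finally show ?thesis using prod_q prod_a by linarith
  next
    case False
    then have binary: "?q i \<in> {1, 2} \<and>
        (\<forall>C\<in>child_digits X i. \<forall>D\<in>child_digits X i. card C = 2 \<and> card D = 2 \<longrightarrow> C = D)" if "i < m" for i
      using q(2)[of i] that by blast
    define b where "b = card {j. j < m \<and> ?q j = 2}"
    have "(\<Prod>i<m. ?q i) = (\<Prod>i<m. if ?q i = 2 then 2 else 1)"
      using binary by (intro prod.cong) auto
    also have "\<dots> = 2 ^ b"
      by (simp add: prod.If_cases b_def Int_def)
    finally have qb: "(\<Prod>i<m. ?q i) = 2 ^ b" .
    have "(\<Prod>i<m. ?q i) \<le> (\<Prod>i<m. ?a i)" using q(1) by (intro prod_mono) auto
    then have b: "card X \<le> 2 ^ b" "2 ^ b \<le> card (lex_orders X)"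
      using qb prod_q prod_a by auto
    show ?thesis
    proof (cases "twin_branching X")
      case True
      then show ?thesis using b by blast
    next
      case False
      have "card X \<le> 1 + b"
        using card_classes_le_without_twins[OF X(1) ne False binary, of m] card_classes_m[OF X(1)]
        by (simp add: b_def)
      \<comment> \<open>For \<open>b = 2\<close>, that is for three points, the next inequality fails.\<close>
      then have "3 \<le> b" using X(2) by linarith
      then have "2 * (1 + b) \<le> 2 ^ b" by (induction b rule: dec_induct) auto
      with \<open>card X \<le> 1 + b\<close> have "2 * card X \<le> 2 ^ b"
        by (meson mult_le_mono2 order_trans)
      then show ?thesis using b(2) by linarith
    qed
  qed
qed

section \<open>Orders that compare one digit first\<close>

definition front_order :: "nat \<Rightarrow> bool \<Rightarrow> bool \<Rightarrow> nat rel" where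
  "front_order j s u = {(x, y) \<in> A \<times> A.
     (if s then c x j < c y j else c y j < c x j) \<or> c x j = c y j \<and> (if u then x < y else y < x)}"

lemma front_order_perm: "front_order j s u \<in> perms_on A"
proof -
  have "trans (front_order j s u)"
    by (rule transI) (auto simp: front_order_def split: if_splits)
  moreover have "irrefl (front_order j s u)" by (auto simp: irrefl_def front_order_def)
  moreover have "total_on A (front_order j s u)"
    by (rule total_onI) (auto simp: front_order_def split: if_splits)
  ultimately show ?thesis
    by (auto simp: perms_on_def strict_linear_order_on_def front_order_def)
qed

text \<open>
  The codes of \<open>x1, x2\<close> part from those of \<open>y1, y2\<close> at a position \<open>i < j\<close>, where \<open>x1, x2\<close> have the same
  digit and so do \<open>y1, y2\<close>. Hence a lexicographic order compares \<open>x1\<close> with \<open>y2\<close> as it compares \<open>x2\<close>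
  with \<open>y1\<close>. An order that looks at digit \<open>j\<close> first compares \<open>x1\<close> with \<open>y2\<close> as it compares \<open>y1\<close> with
  \<open>x2\<close>, that is, the other way round. The four orders differ from each other: the pair \<open>x1, x2\<close> shows the
  direction \<open>s\<close> of the digit, and the pair \<open>x1, y1\<close> the direction \<open>u\<close> of the tie-breaking.
\<close>
lemma twin_branching_four_new_orders:
  assumes X: "X \<subseteq> A" and twins: "twin_branching X"
  obtains j where "j < m"
    "card (range (\<lambda>(s, u). Restr (front_order j s u) X)) = 4"
    "range (\<lambda>(s, u). Restr (front_order j s u) X) \<inter> lex_orders X = {}"
proof -
  obtain j x1 x2 y1 y2 where j: "j < m" and mem: "x1 \<in> X" "x2 \<in> X" "y1 \<in> X" "y2 \<in> X"
    and ag: "agree j x1 x2" "agree j y1 y2" "\<not> agree j x1 y1"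
    and dig: "c x1 j = c y1 j" "c x2 j = c y2 j" "c x1 j \<noteq> c x2 j"
    using twins unfolding twin_branching_def by blast
  define \<phi> where "\<phi> = (\<lambda>(s, u). Restr (front_order j s u) X)"
  have memA: "x1 \<in> A" "x2 \<in> A" "y1 \<in> A" "y2 \<in> A" using mem X by auto
  have s: "(x1, x2) \<in> \<phi> (s, u) \<longleftrightarrow> (s \<longleftrightarrow> c x1 j < c x2 j)" for s u
    using mem memA dig by (auto simp: \<phi>_def front_order_def)
  have "x1 \<noteq> y1" using ag by auto
  then have u: "(x1, y1) \<in> \<phi> (s, u) \<longleftrightarrow> (u \<longleftrightarrow> x1 < y1)" for s u
    using mem memA dig by (auto simp: \<phi>_def front_order_def)
  have "inj \<phi>"
  proof (rule injI, clarify)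
    fix a b a' b' assume "\<phi> (a, b) = \<phi> (a', b')"
    then show "a = a' \<and> b = b'" using s[of a b] s[of a' b'] u[of a b] u[of a' b'] by auto
  qed
  then have "card (range \<phi>) = card (UNIV :: (bool \<times> bool) set)" by (simp add: card_image)
  also have "\<dots> = 4"
    by (rule card_bool_pairs)
  finally have "card (range \<phi>) = 4" .
  moreover have "range \<phi> \<inter> lex_orders X = {}"
  proof -
    have "\<phi> (s, u) \<notin> lex_orders X" for s u
    proof
      assume "\<phi> (s, u) \<in> lex_orders X"
      then obtain h where h: "\<phi> (s, u) = Restr (lex_order h) X" by (auto simp: lex_orders_def)
      obtain i where i: "i < j" "agree i x1 y1" "c x1 i \<noteq> c y1 i"
        using first_difference[OF ag(3)] .
      have ci: "c x2 i = c x1 i" "c y2 i = c y1 i" using ag i(1) by (auto simp: agree_def)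
      have agi: "agree i x1 y2" "agree i y1 x2" "agree i y2 x1" "agree i x2 y1"
        using ag i by (auto simp: agree_def)
      have im: "i < m" using i j by simp
      have "(x1, y2) \<in> \<phi> (s, u) \<longleftrightarrow> h i (c x1 i) < h i (c y1 i)"
           "(y1, x2) \<in> \<phi> (s, u) \<longleftrightarrow> h i (c y1 i) < h i (c x1 i)"
           "(y2, x1) \<in> \<phi> (s, u) \<longleftrightarrow> h i (c y1 i) < h i (c x1 i)"
           "(x2, y1) \<in> \<phi> (s, u) \<longleftrightarrow> h i (c x1 i) < h i (c y1 i)"
        using lex_order_iff[OF _ _ im, of x1 y2 h] lex_order_iff[OF _ _ im, of y1 x2 h]
          lex_order_iff[OF _ _ im, of y2 x1 h] lex_order_iff[OF _ _ im, of x2 y1 h]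
          h mem memA agi ci i(3) by auto
      moreover have "(x1, y2) \<in> \<phi> (s, u) \<longleftrightarrow> (y1, x2) \<in> \<phi> (s, u)"
           "(y2, x1) \<in> \<phi> (s, u) \<longleftrightarrow> (x2, y1) \<in> \<phi> (s, u)"
           "(x1, y2) \<in> \<phi> (s, u) \<or> (y2, x1) \<in> \<phi> (s, u)"
        using mem memA dig by (auto simp: \<phi>_def front_order_def)
      ultimately show False by linarith
    qed
    then show ?thesis by auto
  qed
  ultimately show ?thesis using that[OF j] unfolding \<phi>_def by blast
qed

section \<open>The shattering family\<close>

text \<open>
  The functions of a universal family are far from injective, so ties are broken by the digit itself.
\<close>
definition digit_key :: "(nat \<times> nat \<Rightarrow> nat) \<Rightarrow> nat \<Rightarrow> nat \<Rightarrow> nat" where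
  "digit_key g i a = g (i, a) * N + a"

lemma digit_key_mono:
  assumes "g (i, a) < g (i, b)" "a < N"
  shows "digit_key g i a < digit_key g i b"
proof -
  have "g (i, a) * N + a < Suc (g (i, a)) * N" using assms(2) by simp
  also have "\<dots> \<le> g (i, b) * N" using assms(1) by (intro mult_right_mono) auto
  finally show ?thesis by (simp add: digit_key_def)
qed

lemma inj_on_digit_key: "inj_on (digit_key g i) {..<N}"
proof (rule inj_onI)
  fix a b assume ab: "a \<in> {..<N}" "b \<in> {..<N}" "digit_key g i a = digit_key g i b"
  then have "g (i, a) = g (i, b)"
    using digit_key_mono[of g i a b] digit_key_mono[of g i b a] by force
  then show "a = b" using ab by (simp add: digit_key_def)
qed

text \<open>
  Each of these positions is the first difference of a pair of points of \<open>X\<close>.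
\<close>
lemma card_branching_levels_le:
  assumes "finite X"
  shows "card {i. \<exists>x\<in>X. \<exists>y\<in>X. agree i x y \<and> c x i \<noteq> c y i} \<le> card X * card X"
    and "finite {i. \<exists>x\<in>X. \<exists>y\<in>X. agree i x y \<and> c x i \<noteq> c y i}"
proof -
  let ?B = "{i. \<exists>x\<in>X. \<exists>y\<in>X. agree i x y \<and> c x i \<noteq> c y i}"
  let ?first = "\<lambda>(x, y). THE i. agree i x y \<and> c x i \<noteq> c y i"
  have sub: "?B \<subseteq> ?first ` (X \<times> X)"
  proof
    fix i assume "i \<in> ?B"
    then obtain x y where xy: "x \<in> X" "y \<in> X" "agree i x y" "c x i \<noteq> c y i" by blast
    then have "i = ?first (x, y)"
      by (auto intro!: the_equality[symmetric] dest: first_difference_unique)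
    then show "i \<in> ?first ` (X \<times> X)" using xy by blast
  qed
  then show "finite ?B" using assms by (meson finite_SigmaI finite_imageI finite_subset)
  have "card ?B \<le> card (?first ` (X \<times> X))" using sub assms by (intro card_mono) auto
  also have "\<dots> \<le> card (X \<times> X)" using assms by (intro card_image_le) auto
  finally show "card ?B \<le> card X * card X" by (simp add: card_cartesian_product)
qed

text \<open>
  Only positions at which two points of \<open>X\<close> first differ matter, and only digits that occur there;
  these are at most \<open>card X ^ 3\<close> pairs. On them \<open>h\<close> can be replaced by the rank within the occurring
  digits, which is less than \<open>card X\<close> and hence a pattern that the universal family contains.
\<close>
lemma lex_orders_realised:
  assumes X: "X \<subseteq> A" "card X ^ 3 \<le> K" "K \<le> m * N"
    and universal: "pattern_universal K ({..<m} \<times> {..<N}) P"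
    and K: "0 < K"
  shows "lex_orders X \<subseteq> (\<lambda>g. Restr (lex_order (digit_key g)) X) ` P"
proof
  fix r assume "r \<in> lex_orders X"
  then obtain h where r: "r = Restr (lex_order h) X"
    and h: "\<And>i. i < m \<Longrightarrow> inj_on (h i) ((\<lambda>x. c x i) ` X)"
    by (auto simp: lex_orders_def)
  have finX: "finite X" using X(1) finite_A by (rule finite_subset)
  define V where "V i = (\<lambda>x. c x i) ` X" for i
  define B where "B = {i. \<exists>x\<in>X. \<exists>y\<in>X. agree i x y \<and> c x i \<noteq> c y i} \<inter> {..<m}"
  define R where "R = (\<lambda>(i, x). (i, c x i)) ` (B \<times> X)"
  have finB: "finite B" by (simp add: B_def)
  have cardB: "card B \<le> card X * card X"
    using card_branching_levels_le[OF finX] card_mono[of _ B] unfolding B_def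
    by (meson inf_le1 order_trans)
  have "card R \<le> card (B \<times> X)" unfolding R_def using finB finX by (intro card_image_le) auto
  also have "\<dots> \<le> card X ^ 3"
    using cardB by (simp add: card_cartesian_product power3_eq_cube mult_right_mono)
  finally have cardR: "card R \<le> K" using X(2) by simp
  have "R \<subseteq> {..<m} \<times> {..<N}"
    using X(1) digit_less by (auto simp: R_def B_def)
  \<comment> \<open>Patterns live on sets of size exactly \<open>K\<close>, so \<open>R\<close> is padded.\<close>
  then obtain S where S: "R \<subseteq> S" "S \<subseteq> {..<m} \<times> {..<N}" "card S = K"
    using exists_subset_between[of R K "{..<m} \<times> {..<N}"] cardR X(3)
    by (auto simp: card_cartesian_product)
  define rank where "rank i a = card {b \<in> V i. h i b < h i a}" for i a
  define p where "p = (\<lambda>(i, a). if (i, a) \<in> R then rank i a else 0)"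
  have finV: "finite (V i)" for i using finX by (simp add: V_def)
  have "rank i a < K" if "(i, a) \<in> R" for i a
  proof -
    have a: "a \<in> V i" using that by (auto simp: R_def V_def)
    then have "rank i a < card (V i)"
      unfolding rank_def using finV by (intro psubset_card_mono) auto
    also have "\<dots> \<le> card X" unfolding V_def by (rule card_image_le[OF finX])
    also have "\<dots> \<le> card X ^ 3" by (cases "card X = 0") (simp_all add: self_le_power)
    finally show ?thesis using X(2) by simp
  qed
  then have "p \<in> S \<rightarrow> {..<K}" using K by (auto simp: p_def)
  then obtain g where g: "g \<in> P" "\<forall>x\<in>S. g x = p x"
    using universal S(2,3) unfolding pattern_universal_def by blast
  have less: "digit_key g i (c x i) < digit_key g i (c y i)"
    if i: "i < m" and xy: "x \<in> X" "y \<in> X" "agree i x y" and lt: "h i (c x i) < h i (c y i)" for i x y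
  proof -
    have "c x i \<noteq> c y i" using lt by auto
    then have "i \<in> B" using i xy unfolding B_def by blast
    then have R: "(i, c x i) \<in> R" "(i, c y i) \<in> R" using xy by (auto simp: R_def)
    have "rank i (c x i) < rank i (c y i)"
      unfolding rank_def using lt xy finV by (intro psubset_card_mono) (auto simp: V_def)
    then have "g (i, c x i) < g (i, c y i)"
      using g(2) R S(1) by (auto simp: p_def subset_iff)
    then show ?thesis using digit_key_mono digit_less xy(1) X(1) i by blast
  qed
  have "Restr (lex_order (digit_key g)) X = Restr (lex_order h) X"
  proof -
    have "(x, y) \<in> lex_order (digit_key g) \<longleftrightarrow> (x, y) \<in> lex_order h" if xy: "x \<in> X" "y \<in> X" for x y
    proof (cases "x = y")
      case True
      then show ?thesis by (simp add: lex_order_def)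
    next
      case False
      have xyA: "x \<in> A" "y \<in> A" using xy X(1) by auto
      obtain i where i: "i < m" "agree i x y" "c x i \<noteq> c y i"
        using first_difference[OF not_agree_m[OF xyA False]] .
      have "h i (c x i) \<noteq> h i (c y i)" using h[OF i(1)] i(3) xy by (auto dest: inj_onD)
      then have "digit_key g i (c x i) < digit_key g i (c y i) \<longleftrightarrow> h i (c x i) < h i (c y i)"
        using less[OF i(1) xy i(2)] less[OF i(1) xy(2,1) agree_sym[OF i(2)]]
        by (meson linorder_neqE_nat order_less_asym)
      then show ?thesis using lex_order_iff[OF xyA i] by simp
    qed
    then show ?thesis by auto
  qed
  then show "r \<in> (\<lambda>g. Restr (lex_order (digit_key g)) X) ` P" using r g(1) by blast
qed

text \<open>
  The power \<open>2 ^ b\<close> stays existential because \<open>b\<close> depends on \<open>X\<close>; as \<open>k \<le> 2 ^ b\<close>, it is at least the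
  smallest power of two that is at least \<open>k\<close>.
\<close>
lemma shattering_family:
  assumes k: "4 \<le> k" "k ^ 3 \<le> m * N" and finP: "finite P"
    and universal: "pattern_universal (k ^ 3) ({..<m} \<times> {..<N}) P"
  shows "\<exists>Q \<subseteq> perms_on A. card Q \<le> card P + 4 * m \<and>
    (\<forall>X. X \<subseteq> A \<and> card X = k \<longrightarrow> 2 * k \<le> card (induced_perms Q X) \<or>
      (\<exists>b. k \<le> 2 ^ b \<and> 2 ^ b + 4 \<le> card (induced_perms Q X)))"
proof -
  define L where "L = (\<lambda>g. lex_order (digit_key g)) ` P"
  define T where "T = (\<lambda>(j, s, u). front_order j s u) ` ({..<m} \<times> UNIV \<times> UNIV)"
  have "card L \<le> card P" unfolding L_def by (rule card_image_le[OF finP])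
  moreover have "card T \<le> card ({..<m} \<times> (UNIV :: bool set) \<times> (UNIV :: bool set))"
    unfolding T_def by (intro card_image_le) auto
  ultimately have "card (L \<union> T) \<le> card P + 4 * m"
    using card_Un_le[of L T] by (simp add: card_cartesian_product card_bool_pairs)
  moreover have "L \<union> T \<subseteq> perms_on A"
    using lex_order_perm inj_on_digit_key front_order_perm by (auto simp: L_def T_def)
  moreover have "2 * k \<le> card (induced_perms (L \<union> T) X) \<or>
      (\<exists>b. k \<le> 2 ^ b \<and> 2 ^ b + 4 \<le> card (induced_perms (L \<union> T) X))"
    if X: "X \<subseteq> A" "card X = k" for X
  proof -
    have fin: "finite (induced_perms (L \<union> T) X)"
      using finP by (simp add: induced_perms_def L_def T_def)
    have "lex_orders X \<subseteq> (\<lambda>g. Restr (lex_order (digit_key g)) X) ` P"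
      using X(2) k(1) by (intro lex_orders_realised[OF X(1) _ k(2) universal]) auto
    then have lex: "lex_orders X \<subseteq> induced_perms (L \<union> T) X"
      by (simp add: induced_perms_def L_def image_Un image_image le_supI1)
    have "2 * card X \<le> card (lex_orders X) \<or>
        twin_branching X \<and> (\<exists>b. card X \<le> 2 ^ b \<and> 2 ^ b \<le> card (lex_orders X))"
      using lex_orders_many_or_twins[of X] X k(1) by simp
    then show ?thesis
    proof
      assume "2 * card X \<le> card (lex_orders X)"
      then show ?thesis using card_mono[OF fin lex] X(2) by linarith
    next
      assume "twin_branching X \<and> (\<exists>b. card X \<le> 2 ^ b \<and> 2 ^ b \<le> card (lex_orders X))"
      then obtain b where twins: "twin_branching X" and b: "k \<le> 2 ^ b" "2 ^ b \<le> card (lex_orders X)"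
        using X(2) by blast
      obtain j where j: "j < m" "card (range (\<lambda>(s, u). Restr (front_order j s u) X)) = 4"
        "range (\<lambda>(s, u). Restr (front_order j s u) X) \<inter> lex_orders X = {}"
        using twin_branching_four_new_orders[OF X(1) twins] .
      let ?J = "range (\<lambda>(s, u). Restr (front_order j s u) X)"
      have "front_order j s u \<in> T" for s u
        unfolding T_def using j(1) by (intro image_eqI[where x = "(j, s, u)"]) auto
      then have "?J \<subseteq> induced_perms (L \<union> T) X"
        by (auto simp: induced_perms_def)
      then have "card (?J \<union> lex_orders X) \<le> card (induced_perms (L \<union> T) X)"
        using fin lex by (intro card_mono) auto
      moreover have "card (?J \<union> lex_orders X) = 4 + card (lex_orders X)"
        using j fin lex by (subst card_Un_disjoint) (auto intro: finite_subset)
      ultimately show ?thesis using b by (intro disjI2 exI[of _ b]) linarith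
    qed
  qed
  ultimately show ?thesis by blast
qed

end

section \<open>The upper bound\<close>

lemma shatter_num_le:
  assumes P: "P \<subseteq> perms_on {1..n}"
    and shatters: "\<And>X. X \<subseteq> {1..n} \<Longrightarrow> card X = k \<Longrightarrow> t_shatters t P X"
  shows "shatter_num k n t \<le> card P"
  unfolding shatter_num_def
proof (rule Least_le, intro exI[of _ P] conjI allI impI)
  show "t_shatters t P X" if "X \<subseteq> {1..n} \<and> card X = k" for X using shatters that by simp
qed (use P in simp_all)

lemma shatter_num_le_linear:
  fixes k t :: nat
  assumes k: "4 \<le> k" and t: "t \<le> min (2 * k) (2 ^ nat \<lceil>log 2 (real k)\<rceil> + 4)"
  shows "\<exists>D. \<forall>n m. k ^ 3 \<le> m \<and> n \<le> 2 ^ (m * m) \<longrightarrow> shatter_num k n t \<le> D * m"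
proof -
  define K where "K = k ^ 3"
  have K: "0 < K" using k by (simp add: K_def)
  obtain D where D: "\<And>(G :: (nat \<times> nat) set) m. \<lbrakk>finite G; 0 < m; card G \<le> 2 ^ m\<rbrakk> \<Longrightarrow>
    \<exists>P. pattern_universal K G P \<and> card P \<le> D * m"
    using universal_family_log[OF K] by blast
  have "shatter_num k n t \<le> (2 * D + 4) * m" if m: "K \<le> m" and n: "n \<le> 2 ^ (m * m)" for n m
  proof -
    define N :: nat where "N = 2 ^ m"
    have m0: "0 < m" using m K by simp
    have "card {1..n} \<le> card ({..<m} \<rightarrow>\<^sub>E {..<N})"
      using n by (simp add: card_PiE N_def power_mult)
    then obtain c where c: "c ` {1..n} \<subseteq> {..<m} \<rightarrow>\<^sub>E {..<N}" "inj_on c {1..n}"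
      using inj_on_iff_card_le[of "{1..n}" "{..<m} \<rightarrow>\<^sub>E {..<N}"] by (auto simp: finite_PiE)
    interpret digit_code "{1..n}" c m N
    proof
      show "finite {1..n}" by simp
    next
      fix x i assume "x \<in> {1..n}" "i < m"
      then show "c x i < N" using c(1) by (auto simp: image_subset_iff dest: PiE_mem)
    next
      fix x y assume xy: "x \<in> {1..n}" "y \<in> {1..n}" "\<forall>i<m. c x i = c y i"
      have "c x \<in> {..<m} \<rightarrow>\<^sub>E {..<N}" "c y \<in> {..<m} \<rightarrow>\<^sub>E {..<N}" using c(1) xy(1,2) by blast+
      then have "c x = c y" by (rule PiE_ext) (use xy(3) in simp)
      then show "x = y" using inj_onD[OF c(2)] xy(1,2) by blast
    qed
    have "m \<le> 2 ^ m" using less_exp[of m] by simp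
    then have "m * N \<le> 2 ^ (2 * m)" by (simp add: N_def mult_2 power_add)
    then have "card ({..<m} \<times> {..<N}) \<le> 2 ^ (2 * m)"
      by (simp add: card_cartesian_product)
    then have "\<exists>P. pattern_universal K ({..<m} \<times> {..<N}) P \<and> card P \<le> D * (2 * m)"
      by (rule D[rotated 2]) (use m0 in auto)
    then obtain P where P: "pattern_universal K ({..<m} \<times> {..<N}) P" "card P \<le> D * (2 * m)"
      by blast
    have "P \<subseteq> {..<m} \<times> {..<N} \<rightarrow>\<^sub>E {..<K}" using P(1) by (simp add: pattern_universal_def)
    then have finP: "finite P" by (rule finite_subset) (auto intro: finite_PiE)
    have "m \<le> m * N" by (simp add: N_def)
    then have KmN: "k ^ 3 \<le> m * N" using m unfolding K_def by (rule order_trans[rotated])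
    obtain Q where Q: "Q \<subseteq> perms_on {1..n}" "card Q \<le> card P + 4 * m"
      and sh: "\<forall>X. X \<subseteq> {1..n} \<and> card X = k \<longrightarrow> 2 * k \<le> card (induced_perms Q X) \<or>
        (\<exists>b. k \<le> 2 ^ b \<and> 2 ^ b + 4 \<le> card (induced_perms Q X))"
      using shattering_family[OF k KmN finP P(1)[unfolded K_def]] by (elim exE conjE)
    have "shatter_num k n t \<le> card Q"
    proof (rule shatter_num_le[OF Q(1)])
      fix X assume X: "X \<subseteq> {1..n}" "card X = k"
      have pow: "2 ^ nat \<lceil>log 2 (real k)\<rceil> \<le> (2::nat) ^ b" if "k \<le> 2 ^ b" for b
      proof -
        have "log 2 (real k) \<le> real b" using log2_of_power_le[OF that] k by simp
        then show ?thesis by (intro power_increasing) (auto simp: nat_le_iff ceiling_le_iff)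
      qed
      consider "2 * k \<le> card (induced_perms Q X)"
        | b where "k \<le> 2 ^ b" "2 ^ b + 4 \<le> card (induced_perms Q X)"
        using sh X by metis
      then show "t_shatters t Q X"
        unfolding t_shatters_def
      proof cases
        case 1
        then show "t \<le> card (induced_perms Q X)" using t by simp
      next
        case (2 b)
        have "t \<le> 2 ^ nat \<lceil>log 2 (real k)\<rceil> + 4" using t by simp
        also have "\<dots> \<le> 2 ^ b + 4" using pow[OF 2(1)] by (rule add_right_mono)
        finally show "t \<le> card (induced_perms Q X)" using 2(2) by (rule order_trans)
      qed
    qed
    also have "\<dots> \<le> (2 * D + 4) * m" using Q(2) P(2) by (simp add: algebra_simps)
    finally show ?thesis .
  qed
  then have "\<forall>n m. k ^ 3 \<le> m \<and> n \<le> 2 ^ (m * m) \<longrightarrow> shatter_num k n t \<le> (2 * D + 4) * m"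
    by (simp add: K_def)
  then show ?thesis by (rule exI)
qed

theorem theorem1p7:
  fixes k t :: nat
  assumes "4 \<le> k"
    and "1 \<le> t"
    and "t \<le> min (2 * k) (2 ^ nat \<lceil>log 2 (real k)\<rceil> + 4)"
  shows "(\<lambda>n. real (shatter_num k n t)) \<in> O(\<lambda>n. sqrt (ln (real n)))"
proof -
  obtain D where D: "\<forall>n m. k ^ 3 \<le> m \<and> n \<le> 2 ^ (m * m) \<longrightarrow> shatter_num k n t \<le> D * m"
    using shatter_num_le_linear[OF assms(1,3)] by (elim exE)
  define K where "K = k ^ 3"
  have K: "0 < K" using assms(1) by (simp add: K_def)
  have "real (shatter_num k n t) \<le> 2 * real D / sqrt (ln 2) * sqrt (ln (real n))"
    if n: "2 ^ (K * K) \<le> n" for n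
  proof -
    define s where "s = sqrt (log 2 (real n))"
    define m where "m = nat \<lceil>s\<rceil>"
    have n0: "0 < n" using n by (meson not_gr_zero order.strict_trans2 pos2 zero_less_power)
    have "real (K * K) \<le> log 2 (real n)" by (rule le_log2_of_power[OF n])
    then have "real K \<le> s" unfolding s_def by (intro real_le_rsqrt) (simp add: power2_eq_square)
    moreover have "1 \<le> real K" using K by simp
    ultimately have s1: "1 \<le> s" by linarith
    have sm: "s \<le> real m" "real m \<le> s + 1"
      using s1 unfolding m_def by linarith+
    have m: "K \<le> m" "real m \<le> 2 * s"
      using \<open>real K \<le> s\<close> sm s1 by linarith+
    have "log 2 (real n) \<le> real m ^ 2"
      using sm unfolding s_def by (metis sqrt_le_D)
    then have "real n \<le> 2 powr (real (m * m))"
      using n0 by (subst log_le_iff[symmetric]) (auto simp: power2_eq_square)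
    then have "real n \<le> 2 ^ (m * m)" by (subst (asm) powr_realpow) auto
    then have "n \<le> 2 ^ (m * m)" by (metis of_nat_le_iff of_nat_numeral of_nat_power)
    then have "shatter_num k n t \<le> D * m" using D m(1) by (simp add: K_def)
    then have "real (shatter_num k n t) \<le> real D * real m"
      by (metis of_nat_le_iff of_nat_mult)
    also have "\<dots> \<le> real D * (2 * s)" using m(2) by (intro mult_left_mono) auto
    also have "\<dots> = 2 * real D / sqrt (ln 2) * sqrt (ln (real n))"
      by (simp add: s_def log_def real_sqrt_divide)
    finally show ?thesis .
  qed
  moreover have "0 \<le> ln (real n)" for n by (cases "n = 0") auto
  ultimately show ?thesis
    by (intro bigoI[where c = "2 * real D / sqrt (ln 2)"] eventually_at_top_linorderI[of "2 ^ (K * K)"]) auto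
qed

end
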